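(* If $G$ is a co-comparability graph, then $\mathrm{cub}(G)\le 2\Delta$, where $\Delta$ is the maximum degree of $G$ and $\mathrm{cub}(G)$ denotes the cubicity of $G$.
   Context: All graphs are simple, finite and undirected. Cubicity: a $k$-cube is a Cartesian product $R_1\times\cdots\times R_k$ where each $R_i$ is a closed interval of the form $[a_i,a_i+1]$ on the real line. The cubicity $\mathrm{cub}(G)$ is the minimum $k$ such that each vertex of $G$ can be mapped to a $k$-cube so that two distinct vertices are adjacent in $G$ if and only if their $k$-cubes have non-empty intersection. A graph $G$ is a co-comparability graph if its complement $\overline{G}$ is a comparability graph, i.e. there is a (strict) partial order $\prec$ on $V(G)$ such that distinct vertices $u,v$ are adjacent in $\overline{G}$ if and only if $u\prec v$ or $v\prec u$.
   Formalization: Edgeless graphs with at least two vertices are excluded: they are co-comparability graphs with Δ = 0 but cubicity 1, so the stated bound fails for exactly these graphs. *)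

theory Defs
  imports Complex_Main "HOL-Library.FuncSet" "Graph_Theory.Digraph"
begin

text \<open>
  Undirected graphs are the symmetric digraphs of the locale \<^locale>\<open>graph\<close>: finite, without loops
  and without parallel arcs. Hence \<^const>\<open>out_degree\<close> counts the neighbours of a vertex.
\<close>

definition max_degree :: "('a, 'b) pre_digraph \<Rightarrow> nat" where
  "max_degree G = Max (out_degree G ` verts G)"

definition complement_graph :: "('a, 'b) pre_digraph \<Rightarrow> ('a, 'a \<times> 'a) pre_digraph" where
  "complement_graph G =
    \<lparr> verts = verts G,
      arcs = {(u, v). u \<in> verts G \<and> v \<in> verts G \<and> u \<noteq> v \<and> \<not> u \<rightarrow>\<^bsub>G\<^esub> v},
      tail = fst, head = snd \<rparr>"

definition comparability_graph :: "('a, 'b) pre_digraph \<Rightarrow> bool" where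
  "comparability_graph G \<longleftrightarrow>
    (\<exists>r. irrefl_on (verts G) r \<and> trans_on (verts G) r \<and>
      (\<forall>u \<in> verts G. \<forall>v \<in> verts G. u \<noteq> v \<longrightarrow> (u \<rightarrow>\<^bsub>G\<^esub> v \<longleftrightarrow> (u, v) \<in> r \<or> (v, u) \<in> r)))"

definition cocomparability_graph :: "('a, 'b) pre_digraph \<Rightarrow> bool" where
  "cocomparability_graph G \<longleftrightarrow> comparability_graph (complement_graph G)"

text \<open>
  Points of \<open>k\<close>-dimensional space are functions on \<open>{..<k}\<close>, extended by \<^const>\<open>undefined\<close>.
  The only \<open>0\<close>-cube is a single point, so that complete graphs have cubicity \<open>0\<close>.
\<close>

definition is_cube :: "nat \<Rightarrow> (nat \<Rightarrow> real) set \<Rightarrow> bool" where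
  "is_cube k C \<longleftrightarrow> (\<exists>a. C = (\<Pi>\<^sub>E i\<in>{..<k}. {a i .. a i + 1}))"

definition cube_representation ::
    "('a, 'b) pre_digraph \<Rightarrow> nat \<Rightarrow> ('a \<Rightarrow> (nat \<Rightarrow> real) set) \<Rightarrow> bool" where
  "cube_representation G k f \<longleftrightarrow>
    (\<forall>v \<in> verts G. is_cube k (f v)) \<and>
    (\<forall>u \<in> verts G. \<forall>v \<in> verts G. u \<noteq> v \<longrightarrow> (u \<rightarrow>\<^bsub>G\<^esub> v \<longleftrightarrow> f u \<inter> f v \<noteq> {}))"

definition cubicity :: "('a, 'b) pre_digraph \<Rightarrow> nat" where
  "cubicity G = (LEAST k. \<exists>f. cube_representation G k f)"

lemma PiE_unit_Int_nonempty_iff: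
  fixes a b :: "nat \<Rightarrow> real"
  shows "(\<Pi>\<^sub>E i\<in>{..<k}. {a i .. a i + 1}) \<inter> (\<Pi>\<^sub>E i\<in>{..<k}. {b i .. b i + 1}) \<noteq> {}
    \<longleftrightarrow> (\<forall>i<k. \<bar>a i - b i\<bar> \<le> 1)"
proof -
  have "{x .. x + 1} \<inter> {y .. y + 1} \<noteq> {} \<longleftrightarrow> \<bar>x - y\<bar> \<le> 1" for x y :: real
    by (auto simp: abs_le_iff)
  then show ?thesis
    by (auto simp: PiE_Int PiE_eq_empty_iff)
qed

text \<open>The minimum in the definition of the cubicity is attained.\<close>

lemma (in graph) cube_representation_exists: "\<exists>k f. cube_representation G k f"
proof -
  obtain w where w: "bij_betw w {..<card (verts G)} (verts G)"
    using ex_bij_betw_nat_finite[OF finite_verts] by (auto simp: atLeast0LessThan)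
  define a :: "'a \<Rightarrow> nat \<Rightarrow> real" where
    "a v i = (if v = w i then 0 else if v \<rightarrow>\<^bsub>G\<^esub> w i then 1 else 2)" for v i
  have sym: "u \<rightarrow>\<^bsub>G\<^esub> v \<longleftrightarrow> v \<rightarrow>\<^bsub>G\<^esub> u" for u v
    using sym_arcs by (auto simp: symmetric_def dest: symD)
  have "(\<forall>i<card (verts G). \<bar>a u i - a v i\<bar> \<le> 1) \<longleftrightarrow> u \<rightarrow>\<^bsub>G\<^esub> v"
    if uv: "u \<in> verts G" "v \<in> verts G" "u \<noteq> v" for u v
  proof
    assume *: "\<forall>i<card (verts G). \<bar>a u i - a v i\<bar> \<le> 1"
    obtain i where "i < card (verts G)" "w i = v"
      using w uv by (force simp: bij_betw_def)
    with * uv show "u \<rightarrow>\<^bsub>G\<^esub> v"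
      by (auto simp: a_def split: if_splits)
  qed (use sym uv in \<open>auto simp: a_def\<close>)
  then have "cube_representation G (card (verts G)) (\<lambda>v. \<Pi>\<^sub>E i\<in>{..<card (verts G)}. {a v i .. a v i + 1})"
    by (auto simp: cube_representation_def is_cube_def PiE_unit_Int_nonempty_iff)
  then show ?thesis by blast
qed

text \<open>
  A graph with at least two vertices and no edge has \<^term>\<open>max_degree G = 0\<close> but positive cubicity.
\<close>

lemma (in graph) edgeless_cubicity:
  assumes "arcs G = {}" and "card (verts G) \<ge> 2"
  shows "cocomparability_graph G" and "max_degree G = 0" and "cubicity G > 0"
proof -
  obtain u v where uv: "u \<in> verts G" "v \<in> verts G" "u \<noteq> v"
    using assms(2) card_le_Suc0_iff_eq[OF finite_verts] by force
  have no: "\<not> x \<rightarrow>\<^bsub>G\<^esub> y" for x y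
    using assms(1) by (auto simp: arcs_ends_def)
  obtain h :: "'a \<Rightarrow> nat" where h: "inj_on h (verts G)"
    using finite_imp_inj_to_nat_seg[OF finite_verts] by blast
  have lin: "h x < h y \<or> h y < h x" if "x \<in> verts G" "y \<in> verts G" "x \<noteq> y" for x y
    using h that by (metis inj_onD linorder_neqE_nat)
  have "comparability_graph (complement_graph G)"
    unfolding comparability_graph_def
  proof (intro exI conjI)
    show "irrefl_on (verts (complement_graph G)) {(x, y). h x < h y}"
      by (auto simp: irrefl_on_def)
    show "trans_on (verts (complement_graph G)) {(x, y). h x < h y}"
      by (auto simp: trans_on_def)
    show "\<forall>u \<in> verts (complement_graph G). \<forall>v \<in> verts (complement_graph G). u \<noteq> v \<longrightarrow>
      (u \<rightarrow>\<^bsub>complement_graph G\<^esub> v \<longleftrightarrow> (u, v) \<in> {(x, y). h x < h y} \<or> (v, u) \<in> {(x, y). h x < h y})"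
      using lin no by (simp add: complement_graph_def arcs_ends_conv image_iff)
  qed
  then show "cocomparability_graph G"
    by (simp add: cocomparability_graph_def)
  have "out_degree G ` verts G = {0}"
    using assms(1) uv by (auto simp: out_degree_def out_arcs_def)
  then show "max_degree G = 0"
    by (simp add: max_degree_def)
  have "\<nexists>f. cube_representation G 0 f"
  proof
    assume "\<exists>f. cube_representation G 0 f"
    then obtain f where f: "cube_representation G 0 f" ..
    have "f u = {\<lambda>_. undefined}" "f v = {\<lambda>_. undefined}"
      using f uv by (auto simp: cube_representation_def is_cube_def)
    moreover have "f u \<inter> f v = {}"
      using f uv no by (simp add: cube_representation_def)
    ultimately show False
      by simp
  qed
  moreover have "\<exists>f. cube_representation G (cubicity G) f"
    unfolding cubicity_def by (rule LeastI_ex) (rule cube_representation_exists)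
  ultimately show "cubicity G > 0"
    by (metis gr0I)
qed

end

theory Submission
  imports Defs
begin

text \<open>
  Number the vertices along a linear extension of the partial order on the complement. If \<open>u < v < w\<close>
  and \<open>u\<close>, \<open>w\<close> are adjacent, transitivity forces \<open>v\<close> to be adjacent to \<open>u\<close> or \<open>w\<close>; hence at most
  \<open>2 * (\<Delta> - 1)\<close> vertices lie between \<open>u\<close> and \<open>w\<close>, and the numbering has bandwidth at most
  \<open>b = 2 * \<Delta> - 1\<close>. A graph of bandwidth \<open>b \<ge> 1\<close> has cubicity at most \<open>b + 1\<close>: a small perturbation of
  \<open>j \<mapsto> j / b\<close> separates the non-adjacent pairs at distance at least \<open>b\<close>, and for every residue class
  modulo \<open>b\<close> one further coordinate separates each member \<open>i\<close> of the class from its non-neighbours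
  among \<open>i + 1, \<dots>, i + b - 1\<close>.
\<close>

section \<open>Linear extensions of finite strict orders\<close>

text \<open>By induction on the set: a maximal element \<open>m\<close> receives the largest number,
  and the remaining elements are numbered by the induction hypothesis.\<close>

lemma finite_linear_extension:
  assumes "finite A" "irrefl_on A r" "trans_on A r"
  shows "\<exists>p. inj_on p A \<and> p ` A \<subseteq> {..<card A} \<and>
    (\<forall>u\<in>A. \<forall>v\<in>A. (u, v) \<in> r \<longrightarrow> p u < (p v :: nat))"
  using assms
proof (induction A rule: finite_psubset_induct)
  case (psubset A)
  show ?case
  proof (cases "A = {}")
    case False
    have "\<exists>m\<in>A. \<forall>x\<in>A. x \<noteq> m \<longrightarrow> (m, x) \<notin> r"
    proof (rule Finite_Set.bex_max_element)
      show "asymp_on A (\<lambda>x y. (x, y) \<in> r)"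
        using psubset.prems unfolding asymp_on_def irrefl_on_def trans_on_def by blast
      show "transp_on A (\<lambda>x y. (x, y) \<in> r)"
        using psubset.prems unfolding transp_on_def trans_on_def by blast
    qed (use psubset.hyps False in auto)
    then obtain m where m: "m \<in> A" "\<And>x. x \<in> A \<Longrightarrow> (m, x) \<notin> r"
      using psubset.prems(1) unfolding irrefl_on_def by metis
    have "irrefl_on (A - {m}) r" "trans_on (A - {m}) r"
      using psubset.prems unfolding irrefl_on_def trans_on_def by blast+
    then obtain p where p: "inj_on p (A - {m})" "p ` (A - {m}) \<subseteq> {..<card (A - {m})}"
      "\<And>u v. u \<in> A - {m} \<Longrightarrow> v \<in> A - {m} \<Longrightarrow> (u, v) \<in> r \<Longrightarrow> p u < (p v :: nat)"
      using psubset.IH[of "A - {m}"] m(1) by blast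
    have card: "card A = Suc (card (A - {m}))"
      using m(1) psubset.hyps by (metis card.remove)
    have lt: "p v < card (A - {m})" if "v \<in> A" "v \<noteq> m" for v
      using p(2) that by auto
    let ?p = "p(m := card (A - {m}))"
    have "inj_on ?p A"
    proof (rule inj_onI)
      fix x y assume "x \<in> A" "y \<in> A" "?p x = ?p y"
      then show "x = y"
        using lt[of x] lt[of y] p(1) by (auto simp: inj_on_def split: if_splits)
    qed
    moreover have "?p ` A \<subseteq> {..<card A}"
      using lt card by (auto simp: less_Suc_eq)
    moreover have "\<forall>u\<in>A. \<forall>v\<in>A. (u, v) \<in> r \<longrightarrow> ?p u < ?p v"
      using m p(3) lt by auto
    ultimately show ?thesis by blast
  qed auto
qed

section \<open>Numberings of co-comparability graphs and their bandwidth\<close>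

context graph
begin

lemma dominates_sym: "u \<rightarrow>\<^bsub>G\<^esub> v \<longleftrightarrow> v \<rightarrow>\<^bsub>G\<^esub> u"
  using sym_arcs by (auto simp: symmetric_def dest: symD)

lemma card_neighbours_le: "card {v. u \<rightarrow>\<^bsub>G\<^esub> v} \<le> max_degree G"
proof (cases "u \<in> verts G")
  case True
  have "{v. u \<rightarrow>\<^bsub>G\<^esub> v} = head G ` out_arcs G u"
    by (auto simp: arcs_ends_conv out_arcs_def)
  then have "card {v. u \<rightarrow>\<^bsub>G\<^esub> v} \<le> out_degree G u"
    unfolding out_degree_def by (simp add: card_image_le out_arcs_def)
  also have "\<dots> \<le> max_degree G"
    unfolding max_degree_def using True by simp
  finally show ?thesis .
next
  case False
  then have "{v. u \<rightarrow>\<^bsub>G\<^esub> v} = {}"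
    using adj_in_verts(1) by blast
  then show ?thesis by simp
qed

lemma finite_neighbours: "finite {v. u \<rightarrow>\<^bsub>G\<^esub> v}"
  using adj_in_verts(2) by (blast intro: finite_subset[OF _ finite_verts])

lemma max_degree_pos:
  assumes "u \<rightarrow>\<^bsub>G\<^esub> v"
  shows "max_degree G > 0"
proof -
  have "card {v. u \<rightarrow>\<^bsub>G\<^esub> v} > 0"
    using assms finite_neighbours by (auto simp: card_gt_0_iff)
  also have "\<dots> \<le> max_degree G"
    by (rule card_neighbours_le)
  finally show ?thesis .
qed

lemma cocomparability_umbrella_free_numbering:
  assumes "cocomparability_graph G"
  obtains p :: "'a \<Rightarrow> nat" where "inj_on p (verts G)" "p ` verts G \<subseteq> {..<card (verts G)}"
    "\<And>u v w. v \<in> verts G \<Longrightarrow> p u < p v \<Longrightarrow> p v < p w \<Longrightarrow> u \<rightarrow>\<^bsub>G\<^esub> w \<Longrightarrow> u \<rightarrow>\<^bsub>G\<^esub> v \<or> v \<rightarrow>\<^bsub>G\<^esub> w"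
proof -
  have compl: "u \<rightarrow>\<^bsub>complement_graph G\<^esub> v \<longleftrightarrow> \<not> u \<rightarrow>\<^bsub>G\<^esub> v"
    if "u \<in> verts G" "v \<in> verts G" "u \<noteq> v" for u v
    using that by (simp add: complement_graph_def arcs_ends_conv image_iff)
  obtain r where r: "irrefl_on (verts G) r" "trans_on (verts G) r"
    and adj: "\<And>u v. u \<in> verts G \<Longrightarrow> v \<in> verts G \<Longrightarrow> u \<noteq> v \<Longrightarrow>
      \<not> u \<rightarrow>\<^bsub>G\<^esub> v \<longleftrightarrow> (u, v) \<in> r \<or> (v, u) \<in> r"
    using assms compl
    unfolding cocomparability_graph_def comparability_graph_def
    by (auto simp: complement_graph_def)
  obtain p :: "'a \<Rightarrow> nat" where p: "inj_on p (verts G)" "p ` verts G \<subseteq> {..<card (verts G)}"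
    and mono: "\<And>u v. u \<in> verts G \<Longrightarrow> v \<in> verts G \<Longrightarrow> (u, v) \<in> r \<Longrightarrow> p u < p v"
    using finite_linear_extension[OF finite_verts r] by blast
  have "u \<rightarrow>\<^bsub>G\<^esub> v \<or> v \<rightarrow>\<^bsub>G\<^esub> w"
    if v: "v \<in> verts G" and less: "p u < p v" "p v < p w" and uw: "u \<rightarrow>\<^bsub>G\<^esub> w" for u v w
  proof (rule ccontr)
    assume no: "\<not> (u \<rightarrow>\<^bsub>G\<^esub> v \<or> v \<rightarrow>\<^bsub>G\<^esub> w)"
    have verts: "u \<in> verts G" "w \<in> verts G"
      using uw by (auto dest: adj_in_verts)
    \<comment> \<open>Non-adjacent vertices are comparable in \<open>r\<close>, and monotonicity of
      \<open>p\<close> rules out the reverse direction.\<close>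
    have "(u, v) \<in> r" "(v, w) \<in> r"
      using adj[of u v] adj[of v w] mono[of v u] mono[of w v] no less v verts by auto
    then have "(u, w) \<in> r"
      using r(2) v verts unfolding trans_on_def by blast
    then show False
      using adj[of u w] uw less verts by force
  qed
  with p show thesis by (rule that)
qed

text \<open>Since \<open>p\<close> is onto an initial segment, every number strictly between
  \<open>p u\<close> and \<open>p w\<close> belongs to a vertex, and that vertex is a neighbour of
  \<open>u\<close> or of \<open>w\<close>. The bound thus comes from counting two
  neighbourhoods.\<close>

lemma umbrella_free_bandwidth:
  fixes p :: "'a \<Rightarrow> nat"
  assumes p: "bij_betw p (verts G) {..<n}"
    and umbrella: "\<And>v. v \<in> verts G \<Longrightarrow> p u < p v \<Longrightarrow> p v < p w \<Longrightarrow> u \<rightarrow>\<^bsub>G\<^esub> v \<or> v \<rightarrow>\<^bsub>G\<^esub> w"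
    and uw: "u \<rightarrow>\<^bsub>G\<^esub> w"
  shows "p w \<le> p u + (2 * max_degree G - 1)"
proof -
  have verts: "u \<in> verts G" "w \<in> verts G"
    using uw by (auto dest: adj_in_verts)
  let ?N = "\<lambda>x. {v. x \<rightarrow>\<^bsub>G\<^esub> v}"
  have "{p u<..<p w} \<subseteq> p ` ((?N u - {w}) \<union> (?N w - {u}))"
  proof
    fix i assume i: "i \<in> {p u<..<p w}"
    then have "i < n"
      using bij_betwE[OF p] verts by fastforce
    then obtain v where "v \<in> verts G" "p v = i"
      using bij_betw_imp_surj_on[OF p] by (metis imageE lessThan_iff)
    then show "i \<in> p ` ((?N u - {w}) \<union> (?N w - {u}))"
      using i umbrella[of v] dominates_sym[of v w] by auto
  qed
  then have "card {p u<..<p w} \<le> card (p ` ((?N u - {w}) \<union> (?N w - {u})))"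
    by (intro card_mono) (auto simp: finite_neighbours)
  also have "\<dots> \<le> card ((?N u - {w}) \<union> (?N w - {u}))"
    by (intro card_image_le) (auto simp: finite_neighbours)
  also have "\<dots> \<le> card (?N u - {w}) + card (?N w - {u})"
    by (rule card_Un_le)
  \<comment> \<open>The endpoints are neighbours of each other but do not lie strictly between, so
    each neighbourhood loses one element.\<close>
  also have "\<dots> = (card (?N u) - 1) + (card (?N w) - 1)"
    using uw dominates_sym[of u w] by (simp add: finite_neighbours card_Diff_singleton)
  also have "\<dots> \<le> 2 * (max_degree G - 1)"
    using card_neighbours_le[of u] card_neighbours_le[of w] by simp
  finally have "p w - p u - 1 \<le> 2 * (max_degree G - 1)"
    by simp
  moreover have "max_degree G > 0"
    using uw by (rule max_degree_pos)
  ultimately show ?thesis by simp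
qed

end

section \<open>Coordinates that separate non-adjacent numbers\<close>

text \<open>On the scale of \<open>j / b\<close>, distances other than \<open>b\<close> are off by
  at least one step, so shifts in \<open>[0, 1)\<close> of the numerators cannot change the verdict
  on them. Only pairs at distance exactly \<open>b\<close> feel the shift, which grows from
  \<open>i\<close> to \<open>i + b\<close> exactly when \<open>E i (i + b)\<close> fails.\<close>

lemma distant_pairs_coordinate:
  fixes E :: "nat \<Rightarrow> nat \<Rightarrow> bool"
  assumes b: "b \<ge> 1"
  obtains f :: "nat \<Rightarrow> real" where
    "\<And>i j. i < j \<Longrightarrow> j < n \<Longrightarrow> \<bar>f i - f j\<bar> \<le> 1 \<longleftrightarrow> j < i + b \<or> j = i + b \<and> E i j"
proof -
  \<comment> \<open>The missing edges along the chain of steps of length \<open>b\<close> that ends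
    in \<open>j\<close>. There are at most \<open>j\<close> of them, so for \<open>j < n\<close>
    division by \<open>n + 1\<close> keeps the shift below 1.\<close>
  define S where "S j = {i. i + b \<le> j \<and> i mod b = j mod b \<and> \<not> E i (i + b)}" for j
  define f :: "nat \<Rightarrow> real" where "f j = (real j + card (S j) / real (n + 1)) / real b" for j
  have S_le: "card (S j) \<le> j" for j
  proof -
    have "S j \<subseteq> {..<j}" using b by (auto simp: S_def)
    then show ?thesis using card_mono[of "{..<j}" "S j"] by simp
  qed
  have S_add: "card (S (i + b)) = card (S i) + (if E i (i + b) then 0 else 1)" for i
  proof -
    \<comment> \<open>Members of one residue class are at least \<open>b\<close> apart, so
      \<open>i\<close> is the only possible new element of \<open>S (i + b)\<close>.\<close>
    have "k + b \<le> i" if "k \<le> i" "k mod b = i mod b" "k \<noteq> i" for k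
    proof -
      have "b dvd i - k" using that by (metis mod_eq_dvd_iff_nat)
      then have "b \<le> i - k" using that by (intro dvd_imp_le) auto
      then show ?thesis using that by simp
    qed
    then have "S (i + b) = S i \<union> (if E i (i + b) then {} else {i})"
      by (auto simp: S_def)
    moreover have "finite (S i)"
      by (rule finite_subset[of _ "{..i}"]) (auto simp: S_def)
    moreover have "i \<notin> S i"
      using b by (simp add: S_def)
    ultimately show ?thesis by simp
  qed
  have frac: "0 \<le> card (S j) / real (n + 1)" "card (S j) / real (n + 1) < 1" if "j < n" for j
    using S_le[of j] that by auto
  have "\<bar>f i - f j\<bar> \<le> 1 \<longleftrightarrow> j < i + b \<or> j = i + b \<and> E i j" if ij: "i < j" "j < n" for i j
  proof -
    define d where "d = real j - real i + (card (S j) / real (n + 1) - card (S i) / real (n + 1))"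
    have "f j - f i = d / b"
      by (simp add: f_def d_def diff_divide_distrib add_divide_distrib)
    then have abs: "\<bar>f i - f j\<bar> \<le> 1 \<longleftrightarrow> \<bar>d\<bar> \<le> b"
      using b by (simp add: abs_minus_commute[of "f i"] abs_divide divide_le_eq)
    have "i < n" using ij by simp
    note frac = frac[OF this] frac[OF ij(2)]
    consider "j < i + b" | "j = i + b" | "j > i + b" by linarith
    then show ?thesis
    proof cases
      case 1
      then have "real j + 1 \<le> real i + b" "real i + 1 \<le> real j" using ij by linarith+
      then have "\<bar>d\<bar> \<le> b"
        using frac unfolding d_def by linarith
      with 1 abs show ?thesis by simp
    next
      case 2
      then have "d = b + (if E i j then 0 else 1 / real (n + 1))"
        using S_add[of i] by (simp add: d_def add_divide_distrib)
      with 2 abs show ?thesis by (auto simp: add_pos_pos)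
    next
      case 3
      then have "real i + b + 1 \<le> real j" by linarith
      then have "\<not> \<bar>d\<bar> \<le> b"
        using frac unfolding d_def by linarith
      with 3 abs show ?thesis by simp
    qed
  qed
  then show thesis by (rule that)
qed

text \<open>Members \<open>j\<close> of the class sit at \<open>j / N\<close>; every other number is
  placed one unit to the right of its last class member, and \<open>1 / N\<close> further if the two
  are not adjacent. A member is thus at distance 1 or \<open>1 + 1 / N\<close> from the non-members
  up to the next member, and at distance at most 1 from all earlier non-members.\<close>

lemma residue_class_coordinate:
  fixes E :: "nat \<Rightarrow> nat \<Rightarrow> bool"
  assumes b: "b \<ge> 1"
    and bandwidth: "\<And>i j. i < j \<Longrightarrow> j < n \<Longrightarrow> E i j \<Longrightarrow> j \<le> i + b"
  obtains g :: "nat \<Rightarrow> real" where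
    "\<And>i j. i < j \<Longrightarrow> j < n \<Longrightarrow> E i j \<Longrightarrow> \<bar>g i - g j\<bar> \<le> 1"
    "\<And>i j. i < j \<Longrightarrow> j < n \<Longrightarrow> i mod b = c \<Longrightarrow> j < i + b \<Longrightarrow> \<not> E i j \<Longrightarrow> \<not> \<bar>g i - g j\<bar> \<le> 1"
proof -
  \<comment> \<open>The largest number \<open>\<le> j\<close> in the residue class; it is negative for \<open>j\<close> below the first member.\<close>
  define p where "p j = int j - (int j - int c) mod int b" for j :: nat
  define s :: "nat \<Rightarrow> int" where "s j = p j + (if p j \<ge> 0 \<and> \<not> E (nat (p j)) j then 1 else 0)" for j
  \<comment> \<open>The values \<open>s j\<close> with \<open>j < n\<close> lie above
    \<open>- b\<close> and are at most \<open>n\<close>, so \<open>n + b\<close> bounds all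
    differences that occur.\<close>
  define N where "N = real (n + b)"
  define g :: "nat \<Rightarrow> real" where
    "g j = (if j mod b = c then real j / N else 1 + s j / N)" for j
  have N: "N > 0" using b by (simp add: N_def)
  have p_bounds: "- int b < p j" "p j \<le> int j" for j
    using b pos_mod_bound[of "int b" "int j - int c"] pos_mod_sign[of "int b" "int j - int c"]
    unfolding p_def by linarith+
  have s_bounds: "- int b < s j" "s j \<le> int j + 1" for j
    using p_bounds[of j] by (auto simp: s_def)
  have p_eq: "p j = int i" if "i < j" "j < i + b" "i mod b = c" for i j
  proof -
    have "(int j - int c) mod int b = (int j - int i) mod int b"
      using that(3) by (auto simp: zmod_int mod_diff_right_eq)
    also have "\<dots> = int j - int i" using that by simp
    finally show ?thesis by (simp add: p_def)
  qed
  have other: "j mod b \<noteq> c" if "i < j" "j < i + b" "i mod b = c" for i j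
  proof
    assume "j mod b = c"
    then have "b dvd j - i" using that by (metis mod_eq_dvd_iff_nat less_imp_le)
    then show False using that dvd_imp_le[of b "j - i"] by linarith
  qed
  have "\<bar>g i - g j\<bar> \<le> 1" if ij: "i < j" "j < n" and E: "E i j" for i j
  proof -
    consider "i mod b = c" "j mod b = c" | "i mod b \<noteq> c" "j mod b \<noteq> c"
      | "i mod b = c" "j mod b \<noteq> c" | "i mod b \<noteq> c" "j mod b = c" by blast
    then show ?thesis
    proof cases
      case 1
      then have "g i - g j = (real i - real j) / N"
        by (simp add: g_def diff_divide_distrib)
      moreover have "\<bar>real i - real j\<bar> \<le> N" using ij by (simp add: N_def)
      ultimately show ?thesis using N by (simp add: abs_divide)
    next
      case 2
      then have "g i - g j = (real_of_int (s i) - real_of_int (s j)) / N"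
        by (simp add: g_def diff_divide_distrib)
      moreover have "\<bar>s i - s j\<bar> \<le> int (n + b)"
        using s_bounds[of i] s_bounds[of j] ij by simp
      then have "\<bar>real_of_int (s i) - real_of_int (s j)\<bar> \<le> N"
        unfolding N_def by linarith
      ultimately show ?thesis using N by (simp add: abs_divide)
    next
      case 3
      \<comment> \<open>Bandwidth still allows distance \<open>b\<close>, but then \<open>j\<close>
        would belong to the class as well.\<close>
      have "j \<noteq> i + b" using 3 by auto
      then have "j < i + b" using bandwidth[OF ij E] by simp
      then have "s j = int i" using p_eq[of i j] ij 3 E by (simp add: s_def)
      then show ?thesis using 3 by (simp add: g_def)
    next
      case 4
      have "g i - g j = 1 - (real j - real_of_int (s i)) / N"
        using 4 by (simp add: g_def diff_divide_distrib)
      \<comment> \<open>The possible extra 1 in \<open>s i\<close> does no harm: \<open>s i\<close>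
        is at most \<open>i + 1\<close>, hence at most \<open>j\<close>.\<close>
      moreover have "0 \<le> int j - s i" "int j - s i \<le> int (n + b)"
        using s_bounds[of i] ij by simp_all
      then have "0 \<le> real j - real_of_int (s i)" "real j - real_of_int (s i) \<le> N"
        unfolding N_def by linarith+
      then have "0 \<le> (real j - real_of_int (s i)) / N" "(real j - real_of_int (s i)) / N \<le> 1"
        using N by simp_all
      ultimately show ?thesis by linarith
    qed
  qed
  moreover have "\<not> \<bar>g i - g j\<bar> \<le> 1"
    if ij: "i < j" "j < n" "i mod b = c" "j < i + b" and no: "\<not> E i j" for i j
  proof -
    have "s j = int i + 1" using p_eq[of i j] ij no by (simp add: s_def)
    then have "g j - g i = 1 + 1 / N"
      using ij other[of i j] by (simp add: g_def add_divide_distrib)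
    moreover have "1 / N > 0" using N by simp
    ultimately show ?thesis by linarith
  qed
  ultimately show thesis by (rule that)
qed

text \<open>Coordinate \<open>b\<close> handles pairs at distance at least \<open>b\<close>;
  coordinate \<open>c < b\<close> handles the closer pairs whose smaller number has residue
  \<open>c\<close>. No coordinate separates an adjacent pair.\<close>

lemma bandwidth_cube_coordinates:
  fixes E :: "nat \<Rightarrow> nat \<Rightarrow> bool"
  assumes b: "b \<ge> 1"
    and bandwidth: "\<And>i j. i < j \<Longrightarrow> j < n \<Longrightarrow> E i j \<Longrightarrow> j \<le> i + b"
  obtains a :: "nat \<Rightarrow> nat \<Rightarrow> real" where
    "\<And>i j. i < j \<Longrightarrow> j < n \<Longrightarrow> (\<forall>k<b + 1. \<bar>a i k - a j k\<bar> \<le> 1) \<longleftrightarrow> E i j"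
proof -
  obtain f :: "nat \<Rightarrow> real" where
    f: "\<And>i j. i < j \<Longrightarrow> j < n \<Longrightarrow> \<bar>f i - f j\<bar> \<le> 1 \<longleftrightarrow> j < i + b \<or> j = i + b \<and> E i j"
    by (fact distant_pairs_coordinate[OF b])
  have "\<exists>g :: nat \<Rightarrow> real. (\<forall>i j. i < j \<and> j < n \<and> E i j \<longrightarrow> \<bar>g i - g j\<bar> \<le> 1) \<and>
    (\<forall>i j. i < j \<and> j < n \<and> i mod b = c \<and> j < i + b \<and> \<not> E i j \<longrightarrow> \<not> \<bar>g i - g j\<bar> \<le> 1)" for c
    by (rule residue_class_coordinate[OF b bandwidth, where c = c]) blast+
  then obtain g :: "nat \<Rightarrow> nat \<Rightarrow> real" where
    g: "\<And>c i j. i < j \<Longrightarrow> j < n \<Longrightarrow> E i j \<Longrightarrow> \<bar>g c i - g c j\<bar> \<le> 1"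
       "\<And>c i j. i < j \<Longrightarrow> j < n \<Longrightarrow> i mod b = c \<Longrightarrow> j < i + b \<Longrightarrow> \<not> E i j \<Longrightarrow> \<not> \<bar>g c i - g c j\<bar> \<le> 1"
    by metis
  define a where "a i k = (if k = b then f i else g k i)" for i k
  have "(\<forall>k<b + 1. \<bar>a i k - a j k\<bar> \<le> 1) \<longleftrightarrow> E i j" if ij: "i < j" "j < n" for i j
  proof
    assume close: "\<forall>k<b + 1. \<bar>a i k - a j k\<bar> \<le> 1"
    from close have "\<bar>f i - f j\<bar> \<le> 1" by (auto simp: a_def)
    then consider "j < i + b" | "E i j" using f[OF ij] by blast
    then show "E i j"
    proof cases
      case 1
      have "i mod b < b" using b by simp
      with close have "\<bar>g (i mod b) i - g (i mod b) j\<bar> \<le> 1"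
        by (force simp: a_def dest: spec[of _ "i mod b"])
      then show ?thesis using g(2)[OF ij refl 1] by blast
    qed
  next
    assume E: "E i j"
    then have "\<bar>f i - f j\<bar> \<le> 1" using f[OF ij] bandwidth[OF ij] by force
    then show "\<forall>k<b + 1. \<bar>a i k - a j k\<bar> \<le> 1"
      using g(1)[OF ij E] by (simp add: a_def)
  qed
  then show thesis by (rule that)
qed

section \<open>Upper bounds on the cubicity\<close>

lemma cubicity_le: "cube_representation G k f \<Longrightarrow> cubicity G \<le> k"
  unfolding cubicity_def by (rule Least_le) blast

lemma (in graph) cubicity_le_bandwidth:
  fixes p :: "'a \<Rightarrow> nat"
  assumes p: "inj_on p (verts G)" and b: "b \<ge> 1"
    and bandwidth: "\<And>u v. u \<rightarrow>\<^bsub>G\<^esub> v \<Longrightarrow> p v \<le> p u + b"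
  shows "cubicity G \<le> b + 1"
proof -
  \<comment> \<open>Adjacency transported to numbers. As \<open>p\<close> need not be onto an
    initial segment, numbers of no vertex simply have no neighbours.\<close>
  define E where "E i j \<longleftrightarrow> (\<exists>u v. u \<rightarrow>\<^bsub>G\<^esub> v \<and> p u = i \<and> p v = j)" for i j
  have E: "E (p u) (p v) \<longleftrightarrow> u \<rightarrow>\<^bsub>G\<^esub> v" if "u \<in> verts G" "v \<in> verts G" for u v
    using p that unfolding E_def inj_on_def by (metis adj_in_verts)
  obtain n where n: "\<And>v. v \<in> verts G \<Longrightarrow> p v < n"
    using finite_verts finite_nat_set_iff_bounded[of "p ` verts G"] by auto
  obtain a :: "nat \<Rightarrow> nat \<Rightarrow> real" where
    a: "\<And>i j. i < j \<Longrightarrow> j < n \<Longrightarrow> (\<forall>k<b + 1. \<bar>a i k - a j k\<bar> \<le> 1) \<longleftrightarrow> E i j"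
    using bandwidth_cube_coordinates[OF b, of n E] bandwidth unfolding E_def by blast
  have "(\<forall>k<b + 1. \<bar>a (p u) k - a (p v) k\<bar> \<le> 1) \<longleftrightarrow> u \<rightarrow>\<^bsub>G\<^esub> v"
    if uv: "u \<in> verts G" "v \<in> verts G" "u \<noteq> v" for u v
  proof -
    have "p u \<noteq> p v" using p uv by (auto simp: inj_on_def)
    then consider "p u < p v" | "p v < p u" by linarith
    then show ?thesis
    proof cases
      case 1
      then show ?thesis using a[OF 1 n] uv E by simp
    next
      case 2
      then show ?thesis
        using a[OF 2 n] uv E dominates_sym[of u v] by (simp add: abs_minus_commute)
    qed
  qed
  then have "cube_representation G (b + 1) (\<lambda>v. \<Pi>\<^sub>E i\<in>{..<b + 1}. {a (p v) i .. a (p v) i + 1})"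
    unfolding cube_representation_def is_cube_def PiE_unit_Int_nonempty_iff by blast
  then show ?thesis by (rule cubicity_le)
qed

theorem corollary2:
  fixes G :: "('a, 'b) pre_digraph"
  assumes "graph G"
    and "cocomparability_graph G"
    and "card (verts G) \<ge> 2 \<longrightarrow> arcs G \<noteq> {}"
  shows "cubicity G \<le> 2 * max_degree G"
proof -
  interpret graph G by fact
  show ?thesis
  proof (cases "card (verts G) \<ge> 2")
    case True
    then obtain e where "e \<in> arcs G" using assms(3) by blast
    then have "tail G e \<rightarrow>\<^bsub>G\<^esub> head G e" by (simp add: arcs_ends_conv)
    \<comment> \<open>Positivity makes \<open>2 * max_degree G - 1\<close> an admissible bandwidth,
      at least 1, and keeps the subtraction on naturals from truncating.\<close>
    then have Delta: "max_degree G > 0" by (rule max_degree_pos)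
    obtain p :: "'a \<Rightarrow> nat" where p: "inj_on p (verts G)" "p ` verts G \<subseteq> {..<card (verts G)}"
      and umbrella: "\<And>u v w. v \<in> verts G \<Longrightarrow> p u < p v \<Longrightarrow> p v < p w \<Longrightarrow> u \<rightarrow>\<^bsub>G\<^esub> w \<Longrightarrow>
        u \<rightarrow>\<^bsub>G\<^esub> v \<or> v \<rightarrow>\<^bsub>G\<^esub> w"
      using cocomparability_umbrella_free_numbering[OF assms(2)] by blast
    have "p ` verts G = {..<card (verts G)}"
      using p by (intro card_subset_eq) (auto simp: card_image)
    with p have bij: "bij_betw p (verts G) {..<card (verts G)}"
      by (simp add: bij_betw_def)
    have "p v \<le> p u + (2 * max_degree G - 1)" if "u \<rightarrow>\<^bsub>G\<^esub> v" for u v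
      using umbrella_free_bandwidth[OF bij umbrella that] that by blast
    then have "cubicity G \<le> (2 * max_degree G - 1) + 1"
      using Delta by (intro cubicity_le_bandwidth[OF p(1)]) auto
    then show ?thesis using Delta by simp
  next
    case False
    then have "u = v" if "u \<in> verts G" "v \<in> verts G" for u v
      using that card_le_Suc0_iff_eq[OF finite_verts] by auto
    \<comment> \<open>Without two distinct vertices a single point suffices, so the bound holds
      whatever the value of \<open>max_degree G\<close>, even for the empty graph.\<close>
    then have "cube_representation G 0 (\<lambda>v. \<Pi>\<^sub>E i\<in>{..<0}. {0 .. 0 + 1})"
      unfolding cube_representation_def is_cube_def by blast
    then show ?thesis using cubicity_le by fastforce
  qed
qed

end
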